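(* Let $b>0$ and $a>0$, and define the function $x\mapsto f(x,a,b)$ on $[1,+\infty)$ by $$f(x,a,b)=\left(\zeta(x,b)-\zeta(x,a+b)\right)^{\frac1x}\quad\text{for } x>1,\qquad f(1,a,b)=\sum_{k=0}^{\infty}\left(\frac{1}{k+b}-\frac{1}{k+a+b}\right)=\sum_{k=0}^\infty\frac{a}{(k+b)(k+a+b)}.$$ Then $x\mapsto f(x,a,b)$ is increasing on $[1,+\infty)$ if $0<a<1$, decreasing on $[1,+\infty)$ if $a>1$, and constantly equal to $\frac1b$ on $[1,+\infty)$ if $a=1$.
   Context: For real $x>1$ and $s>0$, $\zeta(x,s)=\sum_{k=0}^{+\infty}(k+s)^{-x}$ denotes the Hurwitz zeta function. "Increasing" and "decreasing" are meant strictly: $h$ is increasing (resp. decreasing) if $x<y$ implies $h(x)<h(y)$ (resp. $h(x)>h(y)$). *)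

theory Defs
  imports "HOL-Analysis.Analysis"
begin

text \<open>Intended for real \<open>x > 1\<close> and \<open>s > 0\<close>, where the series converges
  (\<open>summable_hurwitz_zeta\<close> below).\<close>

definition hurwitz_zeta :: "real \<Rightarrow> real \<Rightarrow> real" where
  "hurwitz_zeta x s = (\<Sum>k. (real k + s) powr (-x))"

text \<open>Only the values at \<open>x \<ge> 1\<close>, \<open>a > 0\<close>, \<open>b > 0\<close> are meaningful.\<close>

definition f :: "real \<Rightarrow> real \<Rightarrow> real \<Rightarrow> real" where
  "f x a b =
     (if x = 1 then (\<Sum>k. 1 / (real k + b) - 1 / (real k + a + b))
      else (hurwitz_zeta x b - hurwitz_zeta x (a + b)) powr (1 / x))"

lemma summable_hurwitz_zeta:
  fixes x s :: real
  assumes "x > 1" "s > 0"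
  shows "summable (\<lambda>k. (real k + s) powr (-x))"
proof (rule summable_comparison_test')
  show "summable (\<lambda>k. real k powr (-x))"
    using assms by (simp add: summable_real_powr_iff)
next
  fix k :: nat assume "k \<ge> 1"
  then show "norm ((real k + s) powr (-x)) \<le> real k powr (-x)"
    using assms by (auto intro!: powr_mono2')
qed

lemma f_1_term:
  fixes a b :: real
  assumes "a > 0" "b > 0"
  shows "1 / (real k + b) - 1 / (real k + a + b) = a / ((real k + b) * (real k + a + b))"
proof -
  have "real k + b \<noteq> 0" "real k + a + b \<noteq> 0"
    using assms of_nat_0_le_iff[of k, where 'a = real] by linarith+
  then show ?thesis by (simp add: field_simps)
qed

lemma summable_f_1:
  fixes a b :: real
  assumes "a > 0" "b > 0"
  shows "summable (\<lambda>k. 1 / (real k + b) - 1 / (real k + a + b))"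
proof (rule summable_comparison_test')
  show "summable (\<lambda>k. a * (real k + b) powr (-2))"
    using summable_hurwitz_zeta[of 2 b] assms by (intro summable_mult) auto
next
  fix k :: nat assume "k \<ge> 0"
  have p: "real k + b > 0" "real k + a + b > 0"
    using assms of_nat_0_le_iff[of k, where 'a = real] by linarith+
  have "a / ((real k + b) * (real k + a + b)) \<le> a / ((real k + b) * (real k + b))"
    using p assms by (intro divide_left_mono mult_left_mono mult_pos_pos) auto
  also have "\<dots> = a * (real k + b) powr (-2)"
    using p by (simp add: powr_minus divide_inverse power2_eq_square)
  finally show "norm (1 / (real k + b) - 1 / (real k + a + b)) \<le> a * (real k + b) powr (-2)"
    using p assms by (simp only: f_1_term[OF assms]) (simp add: abs_mult)
qed

lemma f_1_alt:
  fixes a b :: real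
  assumes "a > 0" "b > 0"
  shows "f 1 a b = (\<Sum>k. a / ((real k + b) * (real k + a + b)))"
  unfolding f_def by (simp only: f_1_term[OF assms] simp_thms if_True)

end

theory Submission
  imports Defs
begin

text \<open>
  Write \<open>S(x)\<close> for the sum of \<open>u\<^sub>k - v\<^sub>k\<close>, where \<open>u\<^sub>k = (k + b)\<^sup>-\<^sup>x\<close> and \<open>v\<^sub>k = (k + a + b)\<^sup>-\<^sup>x\<close>.
  The corrected partial sums \<open>T\<^sub>n = (\<Sum>k<n. u\<^sub>k - v\<^sub>k) + u\<^sub>n\<close> start at \<open>u\<^sub>0\<close>, also tend to \<open>S(x)\<close>, and
  satisfy \<open>T\<^sub>n\<^sub>+\<^sub>1 - T\<^sub>n = u\<^sub>n\<^sub>+\<^sub>1 - v\<^sub>n\<close>, which has the sign of \<open>a - 1\<close>.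
  For \<open>y > 1\<close> the increments of the convex function \<open>t\<^sup>y\<close> over intervals of a fixed length grow
  with the position of the interval. The step between \<open>T\<^sub>n\<close> and \<open>T\<^sub>n\<^sub>+\<^sub>1\<close> lies to the right
  of the step between \<open>v\<^sub>n\<close> and \<open>u\<^sub>n\<^sub>+\<^sub>1\<close>, so \<open>S(x)\<^sup>y\<close> is compared with \<open>S(x y)\<close> step by step, as
  in the proof of Szegoe's inequality for alternating sums.
\<close>

text \<open>Rearranged, this compares the increments over intervals of the common length
  \<open>t - s\<close> based at \<open>s\<close> and at \<open>r\<close>. The increment has positive
  derivative in the base point, so \<open>r\<close> and \<open>t\<close> need not be
  ordered.\<close>

lemma powr_increment_less:
  fixes y :: real
  assumes "y > 1" "0 < s" "s < r" "s < t"
  shows "r powr y - s powr y < (t + (r - s)) powr y - t powr y"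
proof -
  have "(s + (t - s)) powr y - s powr y < (r + (t - s)) powr y - r powr y"
  proof (rule DERIV_pos_imp_increasing[OF \<open>s < r\<close>])
    fix z assume z: "s \<le> z" "z \<le> r"
    have "((\<lambda>z. (z + (t - s)) powr y - z powr y) has_real_derivative
             y * (z + (t - s)) powr (y - 1) - y * z powr (y - 1)) (at z)"
      using assms z by (auto intro!: derivative_eq_intros)
    moreover have "z powr (y - 1) < (z + (t - s)) powr (y - 1)"
      using assms z by (intro powr_less_mono2) auto
    ultimately show "\<exists>d. ((\<lambda>z. (z + (t - s)) powr y - z powr y) has_real_derivative d) (at z) \<and> 0 < d"
      using assms(1) by (intro exI conjI) auto
  qed
  then show ?thesis by (simp add: algebra_simps)
qed

corollary powr_increment_le:
  fixes y :: real
  assumes "y > 1" "0 < s" "s \<le> r" "s \<le> t"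
  shows "r powr y - s powr y \<le> (t + (r - s)) powr y - t powr y"
  using assms powr_increment_less[of y s r t] by (cases "s = r"; cases "s = t") auto

lemma corrected_partial_sums_tendsto:
  fixes u v :: "nat \<Rightarrow> real"
  assumes "u \<longlonglongrightarrow> 0" "summable (\<lambda>k. u k - v k)"
  shows "(\<lambda>n. (\<Sum>k<n. u k - v k) + u n) \<longlonglongrightarrow> (\<Sum>k. u k - v k)"
  using tendsto_add[OF summable_LIMSEQ[OF assms(2)] assms(1)] by simp

context
  fixes u v :: "nat \<Rightarrow> real" and y :: real
  assumes y: "y > 1"
    and pos: "\<And>k. u k > 0" "\<And>k. v k > 0"
    and lim: "u \<longlonglongrightarrow> 0" "(\<lambda>k. u k powr y) \<longlonglongrightarrow> 0"
    and smm: "summable (\<lambda>k. u k - v k)" "summable (\<lambda>k. u k powr y - v k powr y)"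
    and sum_pos: "(\<Sum>k. u k - v k) > 0"
begin

private definition "T n = (\<Sum>k<n. u k - v k) + u n"

text \<open>Starts at 0 and converges to the difference of the two sides to be compared, so its
  monotonicity decides the inequality.\<close>

private definition "D n = (\<Sum>k<n. u k powr y - v k powr y) + u n powr y - T n powr y"

private lemma T_Suc: "T (Suc n) = T n + (u (Suc n) - v n)"
  by (simp add: T_def)

private lemma D_Suc: "D (Suc n) = D n + (u (Suc n) powr y - v n powr y) + (T n powr y - T (Suc n) powr y)"
  by (simp add: D_def)

private lemma zeroth: "T 0 = u 0" "D 0 = 0"
  by (simp_all add: T_def D_def)

private lemma D_tendsto:
  "D \<longlonglongrightarrow> (\<Sum>k. u k powr y - v k powr y) - (\<Sum>k. u k - v k) powr y"
proof -
  have "T \<longlonglongrightarrow> (\<Sum>k. u k - v k)"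
    unfolding T_def by (rule corrected_partial_sums_tendsto[OF lim(1) smm(1)])
  then have "(\<lambda>n. T n powr y) \<longlonglongrightarrow> (\<Sum>k. u k - v k) powr y"
    using sum_pos by (intro tendsto_intros) auto
  from tendsto_diff[OF corrected_partial_sums_tendsto[OF lim(2) smm(2)] this]
  show ?thesis by (simp add: D_def[abs_def])
qed

text \<open>Here \<open>T\<close> falls by \<open>v n - u (Suc n)\<close> at each step. Since
  \<open>u (Suc n) \<le> T (Suc n)\<close>, the drop in \<open>T n powr y\<close> is at least that
  from \<open>v n powr y\<close> to \<open>u (Suc n) powr y\<close>, so \<open>D\<close>
  increases.\<close>

lemma suminf_diff_powr_less:
  assumes interlaced: "\<And>k. v k < u k" "\<And>k. u (Suc k) < v k"
  shows "(\<Sum>k. u k - v k) powr y < (\<Sum>k. u k powr y - v k powr y)"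
proof -
  have T_ge: "T n \<ge> u n" for n
    using sum_nonneg[of "{..<n}" "\<lambda>k. u k - v k"] interlaced(1) by (simp add: T_def less_imp_le)
  have "D n \<le> D (Suc n)" for n
    using powr_increment_le[of y "u (Suc n)" "v n" "T (Suc n)"] y pos(1)[of "Suc n"]
      interlaced(2)[of n] T_ge[of "Suc n"] by (simp add: D_Suc T_Suc)
  then have "mono D" by (simp add: mono_iff_le_Suc)
  \<comment> \<open>Passing to the limit keeps only weak inequalities, so strictness is secured at
    the first step.\<close>
  moreover have "D 0 < D 1"
    using powr_increment_less[of y "u 1" "v 0" "T 1"] y pos(1)[of 1] interlaced(1)[of 0]
      interlaced(2)[of 0] T_Suc[of 0] D_Suc[of 0] zeroth by simp
  ultimately show ?thesis
    using incseq_le[OF _ D_tendsto, of 1] zeroth by simp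
qed

text \<open>Now \<open>T\<close> rises from \<open>u 0\<close>, which bounds every
  \<open>u n\<close> and hence every \<open>v n\<close>. The same comparison of increments, with
  \<open>v n\<close> below \<open>T n\<close>, makes \<open>D\<close> decrease.\<close>

lemma suminf_diff_powr_greater:
  assumes decr: "\<And>k. u (Suc k) < u k" and gap: "\<And>k. v k < u (Suc k)"
  shows "(\<Sum>k. u k powr y - v k powr y) < (\<Sum>k. u k - v k) powr y"
proof -
  have u_le: "u n \<le> u 0" for n
    using decr by (induction n) (auto intro: less_imp_le order_trans)
  have "u 0 \<le> T n" for n
  proof (induction n)
    case (Suc n)
    then show ?case using gap[of n] by (simp add: T_Suc)
  qed (simp add: zeroth)
  then have T_ge: "v n \<le> T n" for n
    using u_le[of "Suc n"] gap[of n] by (meson less_imp_le order_trans)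
  have "D (Suc n) \<le> D n" for n
    using powr_increment_le[of y "v n" "u (Suc n)" "T n"] y pos(2)[of n] gap[of n] T_ge[of n]
    by (simp add: D_Suc T_Suc)
  then have "decseq D" by (simp add: decseq_Suc_iff)
  moreover have "D 1 < D 0"
    using powr_increment_less[of y "v 0" "u 1" "T 0"] y pos(2)[of 0] gap[of 0] decr[of 0]
      T_Suc[of 0] D_Suc[of 0] zeroth by simp
  ultimately show ?thesis
    using decseq_ge[OF _ D_tendsto, of 1] zeroth by simp
qed

end

lemma shifted_powr_tendsto_0:
  fixes b x :: real
  assumes "x > 0"
  shows "(\<lambda>k. (real k + b) powr (-x)) \<longlonglongrightarrow> 0"
proof (rule tendsto_neg_powr)
  show "filterlim (\<lambda>k. real k + b) at_top sequentially"
    using filterlim_tendsto_add_at_top[OF tendsto_const filterlim_real_sequentially, of b]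
    by (simp add: add.commute)
qed (use assms in simp)

text \<open>Subtracting termwise keeps the series convergent at \<open>x = 1\<close>, where each
  zeta series alone diverges; this treats the endpoint uniformly.\<close>

definition zeta_diff :: "real \<Rightarrow> real \<Rightarrow> real \<Rightarrow> real" where
  "zeta_diff x a b = (\<Sum>k. (real k + b) powr (-x) - (real k + a + b) powr (-x))"

context
  fixes a b :: real
  assumes b: "b > 0" and a: "a > 0"
begin

lemma summable_zeta_diff:
  assumes "x \<ge> 1"
  shows "summable (\<lambda>k. (real k + b) powr (-x) - (real k + a + b) powr (-x))"
proof (cases "x = 1")
  case True
  then show ?thesis
    using summable_f_1[OF a b] a b by (simp add: powr_minus divide_inverse)
next
  case False
  with assms a b show ?thesis
    using summable_diff[OF summable_hurwitz_zeta[of x b] summable_hurwitz_zeta[of x "a + b"]]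
    by (simp add: add.assoc)
qed

lemma zeta_diff_pos:
  assumes "x \<ge> 1"
  shows "zeta_diff x a b > 0"
  unfolding zeta_diff_def using assms a b
  by (intro suminf_pos summable_zeta_diff) (auto intro!: powr_less_mono2_neg)

lemma f_eq_zeta_diff_powr:
  assumes "x \<ge> 1"
  shows "f x a b = zeta_diff x a b powr (1 / x)"
proof (cases "x = 1")
  case True
  then show ?thesis
    \<comment> \<open>Positivity lets the outer \<open>powr 1\<close> be dropped.\<close>
    using zeta_diff_pos[of 1] a b
    by (simp add: f_def zeta_diff_def powr_minus divide_inverse)
next
  case False
  with assms a b show ?thesis
    using suminf_diff[OF summable_hurwitz_zeta[of x b] summable_hurwitz_zeta[of x "a + b"]]
    by (simp add: f_def zeta_diff_def hurwitz_zeta_def add.assoc)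
qed

text \<open>The exponent \<open>y = q / p\<close> turns the terms for \<open>p\<close> into those
  for \<open>q\<close>. Whether \<open>a\<close> is below or above 1 decides on which side of
  \<open>u (Suc k)\<close> the term \<open>v k\<close> lies.\<close>

lemma
  assumes "1 \<le> p" "p < q"
  shows zeta_diff_powr_less: "a < 1 \<Longrightarrow> zeta_diff p a b powr (q / p) < zeta_diff q a b"
    and zeta_diff_powr_greater: "a > 1 \<Longrightarrow> zeta_diff q a b < zeta_diff p a b powr (q / p)"
proof -
  define u v where "u = (\<lambda>k. (real k + b) powr (-p))" and "v = (\<lambda>k. (real k + a + b) powr (-p))"
  have u_q: "(\<lambda>k. u k powr (q / p)) = (\<lambda>k. (real k + b) powr (-q))"
    and v_q: "(\<lambda>k. v k powr (q / p)) = (\<lambda>k. (real k + a + b) powr (-q))"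
    using assms by (simp_all add: u_def v_def powr_powr)
  have y: "q / p > 1" using assms by simp
  have pos: "\<And>k. u k > 0" "\<And>k. v k > 0"
    using a b by (auto simp: u_def v_def add_nonneg_eq_0_iff)
  have lim: "u \<longlonglongrightarrow> 0" "(\<lambda>k. u k powr (q / p)) \<longlonglongrightarrow> 0"
    unfolding u_q using assms by (auto simp: u_def intro!: shifted_powr_tendsto_0)
  have smm: "summable (\<lambda>k. u k - v k)"
    "summable (\<lambda>k. u k powr (q / p) - v k powr (q / p))"
    using summable_zeta_diff[of p] summable_zeta_diff[of q] assms fun_cong[OF u_q] fun_cong[OF v_q]
    by (simp_all add: u_def v_def)
  have eqs: "zeta_diff p a b = (\<Sum>k. u k - v k)"
    "zeta_diff q a b = (\<Sum>k. u k powr (q / p) - v k powr (q / p))"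
    unfolding zeta_diff_def fun_cong[OF u_q] fun_cong[OF v_q] by (simp_all add: u_def v_def)
  have sum_pos: "(\<Sum>k. u k - v k) > 0"
    using zeta_diff_pos[of p] assms eqs by simp
  have v_less: "v k < u k" and u_decr: "u (Suc k) < u k" for k
    using assms a b by (auto simp: u_def v_def intro!: powr_less_mono2_neg)
  show "zeta_diff p a b powr (q / p) < zeta_diff q a b" if "a < 1"
    unfolding eqs
  proof (rule suminf_diff_powr_less[OF y pos lim smm sum_pos v_less])
    show "u (Suc k) < v k" for k
      using that assms a b by (auto simp: u_def v_def intro!: powr_less_mono2_neg)
  qed
  show "zeta_diff q a b < zeta_diff p a b powr (q / p)" if "a > 1"
    unfolding eqs
  proof (rule suminf_diff_powr_greater[OF y pos lim smm sum_pos u_decr])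
    show "v k < u (Suc k)" for k
      using that assms a b by (auto simp: u_def v_def intro!: powr_less_mono2_neg)
  qed
qed

text \<open>Gives \<open>f p a b\<close> the outer exponent \<open>1 / q\<close> of
  \<open>f q a b\<close>, so that only the bases remain to be compared.\<close>

lemma f_eq_powr_powr:
  assumes "1 \<le> p" "1 \<le> q"
  shows "f p a b = (zeta_diff p a b powr (q / p)) powr (1 / q)"
  using assms by (simp add: f_eq_zeta_diff_powr powr_powr)

end

text \<open>For \<open>a = 1\<close> the series telescopes and its terms tend to 0, leaving the term
  of index 0.\<close>

lemma zeta_diff_1:
  assumes "b > 0" "x \<ge> 1"
  shows "zeta_diff x 1 b = b powr (-x)"
  using telescope_sums'[OF shifted_powr_tendsto_0[of x b]] assms
  by (simp add: zeta_diff_def sums_iff algebra_simps)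

theorem theorem1:
  fixes a b :: real
  assumes "b > 0" and "a > 0"
  shows "(a < 1 \<longrightarrow> strict_mono_on {1..} (\<lambda>x. f x a b)) \<and>
         (a > 1 \<longrightarrow> strict_antimono_on {1..} (\<lambda>x. f x a b)) \<and>
         (a = 1 \<longrightarrow> (\<forall>x\<in>{1..}. f x a b = 1 / b))"
proof (intro conjI impI ballI)
  assume "a < 1"
  then have "f p a b < f q a b" if "1 \<le> p" "p < q" for p q
    using zeta_diff_powr_less[OF assms that] that
    by (auto simp: f_eq_powr_powr[OF assms, of p q] f_eq_zeta_diff_powr[OF assms, of q]
        intro!: powr_less_mono2)
  then show "strict_mono_on {1..} (\<lambda>x. f x a b)"
    by (simp add: strict_mono_on_def)
next
  assume "a > 1"
  then have "f q a b < f p a b" if "1 \<le> p" "p < q" for p q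
    using zeta_diff_powr_greater[OF assms that] zeta_diff_pos[OF assms, of q] that
    by (auto simp: f_eq_powr_powr[OF assms, of p q] f_eq_zeta_diff_powr[OF assms, of q]
        intro!: powr_less_mono2)
  then show "strict_antimono_on {1..} (\<lambda>x. f x a b)"
    by (simp add: monotone_on_def)
next
  fix x :: real
  assume "a = 1" "x \<in> {1..}"
  then have x: "x \<ge> 1" by simp
  have "f x a b = (b powr (-x)) powr (1 / x)"
    using f_eq_zeta_diff_powr[OF assms x] zeta_diff_1[OF assms(1) x] \<open>a = 1\<close> by simp
  also have "\<dots> = b powr (-1)"
    using x by (simp add: powr_powr)
  finally show "f x a b = 1 / b"
    using assms(1) by (simp add: powr_neg_one)
qed

end
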